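(* For every positive integer $m$, let $\mathrm{O1}(m)$ denote the number of partitions of $m$ in which no odd part is repeated and the largest part is even, and let $\mathrm{pod}(m)$ denote the number of partitions of $m$ in which no odd part is repeated. Then for all integers $n>1$, \[ \mathrm{O1}(n)+\mathrm{O1}(n-1)=\mathrm{pod}(n). \]
   Context: A partition of $m$ is a finite non-increasing sequence of positive integers $\lambda_1\ge \lambda_2\ge\cdots\ge\lambda_k$ with sum $m$; its parts are the $\lambda_i$ and its largest part is $\lambda_1$. "No odd part is repeated" means every odd integer occurs at most once among the parts (even parts may repeat). *)

theory Defs
  imports Main
begin

definition partitions :: "nat \<Rightarrow> nat list set" where
  "partitions m = {xs. sorted_wrt (\<ge>) xs \<and> (\<forall>x\<in>set xs. 0 < x) \<and> sum_list xs = m}"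

definition no_odd_part_repeated :: "nat list \<Rightarrow> bool" where
  "no_odd_part_repeated xs \<longleftrightarrow> (\<forall>k. odd k \<longrightarrow> count_list xs k \<le> 1)"

text \<open>Both counts below are intended for \<open>m > 0\<close>. Then every partition of \<open>m\<close> is
  nonempty, and its largest part is its first entry \<open>hd xs\<close>.\<close>

definition O1 :: "nat \<Rightarrow> nat" where
  "O1 m = card {xs \<in> partitions m. no_odd_part_repeated xs \<and> even (hd xs)}"

definition pod :: "nat \<Rightarrow> nat" where
  "pod m = card {xs \<in> partitions m. no_odd_part_repeated xs}"

text \<open>Finiteness, so that \<open>card\<close> really counts.\<close>

lemma finite_partitions: "finite (partitions m)"
proof (rule finite_subset)
  have "length xs \<le> sum_list xs" if "\<forall>x\<in>set xs. 0 < x" for xs :: "nat list"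
    using that by (induction xs) auto
  then show "partitions m \<subseteq> {xs. set xs \<subseteq> {..m} \<and> length xs \<le> m}"
    by (auto simp: partitions_def dest: member_le_sum_list)
  show "finite {xs. set xs \<subseteq> {..m} \<and> length xs \<le> m}"
    by (rule finite_lists_length_le) simp
qed

end

theory Submission
  imports Defs
begin

text \<open>Adding 1 to an even largest part makes it odd and strictly larger than every other part, hence
  unrepeated. Conversely, an odd largest part occurs only once, so subtracting 1 from it leaves a
  largest part; for \<open>n > 1\<close> it is not 1, so it stays positive. Thus the partitions of \<open>n - 1\<close>
  counted by \<open>O1\<close> biject with the partitions of \<open>n\<close> counted by \<open>pod\<close> but not by \<open>O1\<close>.\<close>

text \<open>Prepending an odd \<open>x\<close> raises its count by one, so the bound 1 forces its
  count in \<open>xs\<close> to be 0.\<close>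

lemma no_odd_part_repeated_Cons:
  "no_odd_part_repeated (x # xs) \<longleftrightarrow> no_odd_part_repeated xs \<and> (odd x \<longrightarrow> x \<notin> set xs)"
  unfolding no_odd_part_repeated_def by (auto simp: count_list_0_iff le_Suc_eq)

lemma Cons_in_partitions_iff:
  "x # xs \<in> partitions m \<longleftrightarrow>
    0 < x \<and> (\<forall>y\<in>set xs. y \<le> x) \<and> sorted_wrt (\<ge>) xs \<and> (\<forall>y\<in>set xs. 0 < y) \<and> x + sum_list xs = m"
  by (auto simp: partitions_def)

lemma partitions_not_Nil: "xs \<in> partitions m \<Longrightarrow> 0 < m \<Longrightarrow> xs \<noteq> []"
  by (auto simp: partitions_def)

lemma increment_even_largest_part:
  assumes "x # xs \<in> partitions m" "no_odd_part_repeated (x # xs)" "even x"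
  shows "Suc x # xs \<in> partitions (Suc m)" "no_odd_part_repeated (Suc x # xs)"
  using assms by (auto simp: Cons_in_partitions_iff no_odd_part_repeated_Cons)

lemma decrement_odd_largest_part:
  assumes "Suc x # xs \<in> partitions (Suc m)" "no_odd_part_repeated (Suc x # xs)" "even x" "0 < m"
  shows "x # xs \<in> partitions m" "no_odd_part_repeated (x # xs)"
proof -
  \<comment> \<open>As \<open>x\<close> is even, \<open>Suc x\<close> is odd and so does not recur
    in \<open>xs\<close>; this makes the bound by the largest part strict.\<close>
  have le: "y \<le> x" if "y \<in> set xs" for y
  proof -
    from assms that have "y \<le> Suc x" "y \<noteq> Suc x"
      by (auto simp: Cons_in_partitions_iff no_odd_part_repeated_Cons)
    then show ?thesis by simp
  qed
  have "0 < x"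
  \<comment> \<open>If \<open>x = 0\<close>, then \<open>le\<close> leaves no room for further
    positive parts: the total is 1, so \<open>m = 0\<close>.\<close>
  proof (rule ccontr)
    assume "\<not> 0 < x"
    with le have "\<forall>y\<in>set xs. y = 0" by simp
    then have "sum_list xs = 0" by simp
    with assms(1,4) \<open>\<not> 0 < x\<close> show False
      unfolding Cons_in_partitions_iff by linarith
  qed
  with le assms show "x # xs \<in> partitions m" "no_odd_part_repeated (x # xs)"
    by (auto simp: Cons_in_partitions_iff no_odd_part_repeated_Cons)
qed

lemma bij_betw_increment_largest_part:
  assumes "0 < m"
  shows "bij_betw (\<lambda>xs. Suc (hd xs) # tl xs)
    {xs \<in> partitions m. no_odd_part_repeated xs \<and> even (hd xs)}
    {xs \<in> partitions (Suc m). no_odd_part_repeated xs \<and> odd (hd xs)}"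
    (is "bij_betw ?f ?A ?B")
proof (rule bij_betw_imageI)
  show "inj_on ?f ?A"
  proof (rule inj_onI)
    fix xs ys assume "xs \<in> ?A" "ys \<in> ?A" "?f xs = ?f ys"
    \<comment> \<open>Both lists are nonempty because \<open>m > 0\<close>, so head and tail
      determine them.\<close>
    with assms show "xs = ys" by (cases xs; cases ys) (auto dest: partitions_not_Nil)
  qed
  show "?f ` ?A = ?B"
  proof (intro equalityI subsetI)
    fix ys assume "ys \<in> ?f ` ?A"
    then obtain xs where xs: "xs \<in> ?A" and ys: "ys = ?f xs" by blast
    from xs assms obtain x zs where "xs = x # zs" by (cases xs) (auto dest: partitions_not_Nil)
    with xs increment_even_largest_part[of x zs m] show "ys \<in> ?B"
      by (simp add: ys)
  next
    fix ys assume ys: "ys \<in> ?B"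
    then have "ys \<noteq> []" "odd (hd ys)" by (auto dest: partitions_not_Nil)
    \<comment> \<open>An odd head is nonzero, hence the successor of an even number;
      \<open>x # xs\<close> is the preimage.\<close>
    then obtain x xs where eq: "ys = Suc x # xs" and "even x"
      by (cases ys) (auto elim!: oddE)
    with ys assms decrement_odd_largest_part[of x xs m] have "x # xs \<in> ?A" by simp
    then show "ys \<in> ?f ` ?A" by (rule rev_image_eqI) (simp add: eq)
  qed
qed

theorem theorem1p4:
  fixes n :: nat
  assumes "n > 1"
  shows "O1 n + O1 (n - 1) = pod n"
proof -
  let ?E = "{xs \<in> partitions n. no_odd_part_repeated xs \<and> even (hd xs)}"
  let ?O = "{xs \<in> partitions n. no_odd_part_repeated xs \<and> odd (hd xs)}"
  have "O1 (n - 1) = card ?O"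
    \<comment> \<open>\<open>n > 1\<close> gives both \<open>0 < n - 1\<close> and
      \<open>Suc (n - 1) = n\<close>.\<close>
    using bij_betw_same_card[OF bij_betw_increment_largest_part[of "n - 1"]] assms
    by (simp add: O1_def)
  moreover have "card (?E \<union> ?O) = card ?E + card ?O"
    by (rule card_Un_disjoint) (auto simp: finite_partitions)
  moreover have "?E \<union> ?O = {xs \<in> partitions n. no_odd_part_repeated xs}" by blast
  ultimately show ?thesis by (simp add: O1_def pod_def)
qed

end
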